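(* A directed graph $G=(V,A)$ is a monoid digraph if and only if there exists a vertex $e\in V$ and a submonoid $M\leq \mathrm{End}(G)$ such that for each $x\in V$ there is a unique $\varphi_x\in M$ with $\varphi_x(e)=x$. Moreover, $\varphi_x$ satisfies that for each $(x,y)\in A$ there is $(e,c)\in A$ such that $\varphi_x(c)=y$.
   Context: All semigroups, monoids and directed graphs are finite. Directed graphs may have loops and anti-parallel arcs but no parallel arcs. For a semigroup $S$ and a subset $C\subseteq S$, $\mathrm{Cay}(S,C)$ is the directed graph with vertex set $S$ and arc set $\{(s,sc)\mid s\in S,\ c\in C\}$. A monoid digraph is a directed graph isomorphic to $\mathrm{Cay}(N,C)$ for some monoid $N$ and some subset $C\subseteq N$. For a directed graph $G=(V,A)$, $\mathrm{End}(G)$ is the monoid, under composition, of all maps $\varphi:V\to V$ that map arcs to arcs, i.e., $(\varphi(x),\varphi(y))\in A$ whenever $(x,y)\in A$; a submonoid of it contains the identity map.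
   Formalization: The "moreover" condition is taken as part of the right-hand side of the equivalence (a requirement on e and M), since without it the equivalence fails, e.g. V={0,1}, A={(0,0)}, e=1, M={id, const 0}. *)

theory Defs
  imports
    "Graph_Theory.Pair_Digraph"
    "Graph_Theory.Digraph_Isomorphism"
    "HOL-Algebra.Group"
begin

definition Cay :: "('a, 'm) monoid_scheme \<Rightarrow> 'a set \<Rightarrow> 'a pair_pre_digraph" where
  "Cay S C = \<lparr>pverts = carrier S, parcs = {(s, s \<otimes>\<^bsub>S\<^esub> c) | s c. s \<in> carrier S \<and> c \<in> C}\<rparr>"

text \<open>
  A definition cannot quantify over the type of the elements of \<open>N\<close>. Taking that type to be
  the vertex type of \<open>G\<close> loses nothing: see \<open>monoid_digraphI\<close> below, where the type of \<open>N\<close>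
  is arbitrary.
\<close>
definition monoid_digraph :: "'a pair_pre_digraph \<Rightarrow> bool" where
  "monoid_digraph G \<longleftrightarrow>
    (\<exists>(N :: 'a monoid) C. monoid N \<and> finite (carrier N) \<and> C \<subseteq> carrier N \<and>
       digraph_iso (with_proj (Cay N C)) (with_proj G))"

text \<open>
  Self-maps of the vertex set are represented by extensional functions (constantly \<open>undefined\<close>
  off the vertex set), so that equality of functions is equality of maps on vertices.
\<close>
definition digraph_End :: "'a pair_pre_digraph \<Rightarrow> ('a \<Rightarrow> 'a) monoid" where
  "digraph_End G =
    \<lparr>carrier = {\<phi> \<in> pverts G \<rightarrow>\<^sub>E pverts G. \<forall>x y. (x, y) \<in> parcs G \<longrightarrow> (\<phi> x, \<phi> y) \<in> parcs G},
     mult = compose (pverts G),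
     one = (\<lambda>x \<in> pverts G. x)\<rparr>"

lemma monoid_digraph_End:
  assumes "pair_wf_digraph G"
  shows "monoid (digraph_End G)"
proof -
  interpret pair_wf_digraph G by fact
  show ?thesis
    by (rule monoidI)
      (auto simp: digraph_End_def compose_def PiE_iff extensional_def fun_eq_iff restrict_def
        dest: in_arcsD1 in_arcsD2)
qed

lemma monoid_digraphI:
  fixes N :: "'b monoid" and G :: "'a pair_pre_digraph"
  assumes N: "monoid N" and fin: "finite (carrier N)" and C: "C \<subseteq> carrier N"
    and iso: "digraph_iso (with_proj (Cay N C)) (with_proj G)"
  shows "monoid_digraph G"
proof -
  interpret N: monoid N by fact
  obtain f where f: "pre_digraph.digraph_isomorphism (with_proj (Cay N C)) f"
    and G: "with_proj G = app_iso f (with_proj (Cay N C))"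
    using iso unfolding digraph_iso_def by blast
  define g where "g = iso_verts f"
  define h where "h = inv_into (carrier N) g"
  have inj: "inj_on g (carrier N)"
    using f by (simp add: pre_digraph.digraph_isomorphism_def g_def Cay_def)
  have V: "pverts G = g ` carrier N"
    using arg_cong[OF G, of verts] by (simp add: g_def Cay_def)
  have hd: "iso_tail f = fst" "iso_head f = snd"
    using arg_cong[OF G, of tail] arg_cong[OF G, of head] by simp_all
  have arc: "iso_arcs f a = (g (fst a), g (snd a))" if "a \<in> parcs (Cay N C)" for a
    using f that hd by (simp add: pre_digraph.digraph_isomorphism_def g_def prod_eq_iff)
  have A: "parcs G = (\<lambda>a. (g (fst a), g (snd a))) ` parcs (Cay N C)"
    using arg_cong[OF G, of arcs] arc by (simp cong: image_cong)
  have hg: "h (g x) = x" if "x \<in> carrier N" for x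
    using inj that by (simp add: h_def)
  define N' where "N' = \<lparr>carrier = g ` carrier N, mult = (\<lambda>x y. g (h x \<otimes>\<^bsub>N\<^esub> h y)), one = g \<one>\<^bsub>N\<^esub>\<rparr>"
  have N': "monoid N'"
    by (rule monoidI) (auto simp: N'_def hg N.m_assoc)
  have arcs_eq: "parcs (Cay N' (g ` C)) = parcs G"
    unfolding A
  proof (intro equalityI subsetI)
    fix a assume "a \<in> parcs (Cay N' (g ` C))"
    then obtain s c where sc: "s \<in> carrier N" "c \<in> C" "a = (g s, g (s \<otimes>\<^bsub>N\<^esub> c))"
      using C by (auto simp: Cay_def N'_def hg subset_iff)
    then have "(s, s \<otimes>\<^bsub>N\<^esub> c) \<in> parcs (Cay N C)" by (auto simp: Cay_def)
    then show "a \<in> (\<lambda>a. (g (fst a), g (snd a))) ` parcs (Cay N C)"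
      using sc by force
  next
    fix a assume "a \<in> (\<lambda>a. (g (fst a), g (snd a))) ` parcs (Cay N C)"
    then obtain s c where sc: "s \<in> carrier N" "c \<in> C" "a = (g s, g (s \<otimes>\<^bsub>N\<^esub> c))"
      by (auto simp: Cay_def)
    moreover from this have "g (s \<otimes>\<^bsub>N\<^esub> c) = g s \<otimes>\<^bsub>N'\<^esub> g c"
      using C by (auto simp: N'_def hg subset_iff)
    ultimately show "a \<in> parcs (Cay N' (g ` C))"
      by (auto simp: Cay_def N'_def)
  qed
  have eq: "Cay N' (g ` C) = G"
    using arcs_eq V by (intro pair_pre_digraph.equality) (simp_all add: Cay_def N'_def)
  have wf: "wf_digraph (with_proj (Cay N' (g ` C)))"
    using C unfolding wf_digraph_def
    by (auto simp: Cay_def N'_def hg subset_iff)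
  let ?i = "\<lparr>iso_verts = id, iso_arcs = id, iso_head = snd, iso_tail = fst\<rparr>"
  have "digraph_iso (with_proj (Cay N' (g ` C))) (with_proj G)"
    unfolding digraph_iso_def
    by (rule exI[of _ ?i])
      (use wf in \<open>simp add: eq pre_digraph.digraph_isomorphism_def app_iso_def with_proj_def\<close>)
  moreover have "finite (carrier N')" "g ` C \<subseteq> carrier N'"
    using fin C by (auto simp: N'_def)
  ultimately show ?thesis
    using N' unfolding monoid_digraph_def by blast
qed

end

theory Submission
  imports Defs
begin

text \<open>
  Left multiplications by elements of a monoid are endomorphisms of its Cayley digraph, and they
  form a submonoid acting regularly from the neutral element. Conversely, identifying \<open>\<phi>\<^sub>x\<close> with
  \<open>x = \<phi>\<^sub>x e\<close> transports composition to the product \<open>x y = \<phi>\<^sub>x y\<close> on the vertices. The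
  out-neighbours of \<open>e\<close> then serve as connection set: they yield only arcs because every
  \<open>\<phi>\<^sub>x\<close> is an endomorphism, and all arcs because of the lifting condition.
\<close>

text \<open>An isomorphism record has separate components for arcs, tails and heads. Since
  \<open>with_proj\<close> fixes tail and head to be \<open>fst\<close> and \<open>snd\<close> on
  both sides, the arc map is forced by the vertex map.\<close>

lemma pair_pre_digraph_isoE:
  fixes H :: "'a pair_pre_digraph" and G :: "'b pair_pre_digraph"
  assumes "digraph_iso (with_proj H) (with_proj G)"
  obtains g where "inj_on g (pverts H)" "pverts G = g ` pverts H"
    "parcs G = map_prod g g ` parcs H"
proof -
  obtain f where f: "pre_digraph.digraph_isomorphism (with_proj H) f"
    and G: "with_proj G = app_iso f (with_proj H)"
    using assms unfolding digraph_iso_def by blast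
  define g where "g = iso_verts f"
  have hd: "iso_tail f = fst" "iso_head f = snd"
    using arg_cong[OF G, of tail] arg_cong[OF G, of head] by simp_all
  have arc: "iso_arcs f a = map_prod g g a" if "a \<in> parcs H" for a
    using f that hd by (simp add: pre_digraph.digraph_isomorphism_def g_def prod_eq_iff)
  show thesis
  proof
    show "inj_on g (pverts H)"
      using f by (simp add: pre_digraph.digraph_isomorphism_def g_def)
    show "pverts G = g ` pverts H"
      using arg_cong[OF G, of verts] by (simp add: g_def)
    show "parcs G = map_prod g g ` parcs H"
      using arg_cong[OF G, of arcs] arc by (simp cong: image_cong)
  qed
qed

lemma digraph_iso_refl:
  assumes "pair_wf_digraph G"
  shows "digraph_iso (with_proj G) (with_proj G)"
proof -
  interpret pair_wf_digraph G by fact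
  show ?thesis
    unfolding digraph_iso_def
    by (rule exI[of _ "\<lparr>iso_verts = id, iso_arcs = id, iso_head = snd, iso_tail = fst\<rparr>"])
      (use wf_digraph_axioms in
        \<open>simp add: pre_digraph.digraph_isomorphism_def app_iso_def with_proj_def\<close>)
qed

lemma monoid_digraph_imp_regular_submonoid:
  assumes "monoid_digraph G"
  obtains e M where "e \<in> pverts G" "submonoid M (digraph_End G)"
    "\<forall>x \<in> pverts G. \<exists>!\<phi>. \<phi> \<in> M \<and> \<phi> e = x"
    "\<forall>x y. (x, y) \<in> parcs G \<longrightarrow>
      (\<forall>\<phi> \<in> M. \<phi> e = x \<longrightarrow> (\<exists>c. (e, c) \<in> parcs G \<and> \<phi> c = y))"
proof -
  obtain N :: "'a monoid" and C where "monoid N" and C: "C \<subseteq> carrier N"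
    and iso: "digraph_iso (with_proj (Cay N C)) (with_proj G)"
    using assms unfolding monoid_digraph_def by blast
  interpret N: monoid N by fact
  have verts_Cay: "pverts (Cay N C) = carrier N"
    by (simp add: Cay_def)
  obtain g where inj: "inj_on g (carrier N)" and V: "pverts G = g ` carrier N"
    and A: "parcs G = map_prod g g ` parcs (Cay N C)"
    by (rule pair_pre_digraph_isoE[OF iso, unfolded verts_Cay])
  have CD: "c \<in> carrier N" if "c \<in> C" for c
    using C that by blast
  define h where "h = inv_into (carrier N) g"
  have hg [simp]: "h (g n) = n" if "n \<in> carrier N" for n
    using inj that by (simp add: h_def)
  have arc_iff: "a \<in> parcs G \<longleftrightarrow> (\<exists>s c. s \<in> carrier N \<and> c \<in> C \<and> a = (g s, g (s \<otimes>\<^bsub>N\<^esub> c)))" for a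
    unfolding A Cay_def by (force simp: image_iff)
  \<comment> \<open>Left multiplication by \<open>n\<close>, transported to the vertices of
    \<open>G\<close> along \<open>g\<close>; the restriction makes it extensional, as
    \<open>digraph_End\<close> demands.\<close>
  define L where "L n = (\<lambda>v \<in> pverts G. g (n \<otimes>\<^bsub>N\<^esub> h v))" for n
  have L_g [simp]: "L n (g m) = g (n \<otimes>\<^bsub>N\<^esub> m)" if "m \<in> carrier N" for n m
    using that by (simp add: L_def V)
  have L_End: "L n \<in> carrier (digraph_End G)" if n: "n \<in> carrier N" for n
  proof -
    have "(L n x, L n y) \<in> parcs G" if xy: "(x, y) \<in> parcs G" for x y
    proof -
      obtain s c where sc: "s \<in> carrier N" "c \<in> C" "x = g s" "y = g (s \<otimes>\<^bsub>N\<^esub> c)"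
        using xy by (auto simp: arc_iff)
      show ?thesis
        \<comment> \<open>By associativity \<open>n (s c) = (n s) c\<close>, so the image arc starts
          at \<open>g (n s)\<close> and keeps the label \<open>c\<close>.\<close>
        unfolding arc_iff
        by (rule exI[of _ "n \<otimes>\<^bsub>N\<^esub> s"], rule exI[of _ c])
          (use sc n in \<open>simp add: CD N.m_assoc\<close>)
    qed
    moreover have "L n \<in> pverts G \<rightarrow>\<^sub>E pverts G"
      using n by (auto simp: L_def V)
    ultimately show ?thesis by (simp add: digraph_End_def)
  qed
  have L_mult: "compose (pverts G) (L n) (L m) = L (n \<otimes>\<^bsub>N\<^esub> m)"
    if "n \<in> carrier N" "m \<in> carrier N" for n m
    using that by (auto simp: compose_def L_def V N.m_assoc fun_eq_iff inj_on_eq_iff[OF inj])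
  have L_one: "L \<one>\<^bsub>N\<^esub> = (\<lambda>x \<in> pverts G. x)"
    by (auto simp: L_def V fun_eq_iff)
  let ?e = "g \<one>\<^bsub>N\<^esub>" and ?M = "L ` carrier N"
  show thesis
  proof
    show "?e \<in> pverts G"
      by (simp add: V)
    show "submonoid ?M (digraph_End G)"
    proof
      show "?M \<subseteq> carrier (digraph_End G)"
        using L_End by blast
      show "x \<otimes>\<^bsub>digraph_End G\<^esub> y \<in> ?M" if "x \<in> ?M" "y \<in> ?M" for x y
        using that by (auto simp: digraph_End_def L_mult)
      show "\<one>\<^bsub>digraph_End G\<^esub> \<in> ?M"
        using L_one[symmetric] by (auto simp: digraph_End_def)
    qed
    \<comment> \<open>\<open>L n\<close> sends \<open>?e\<close> to \<open>g n\<close>, from which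
      injectivity of \<open>g\<close> recovers \<open>n\<close>.\<close>
    show "\<forall>x \<in> pverts G. \<exists>!\<phi>. \<phi> \<in> ?M \<and> \<phi> ?e = x"
      by (auto simp: V inj_on_eq_iff[OF inj])
    show "\<forall>x y. (x, y) \<in> parcs G \<longrightarrow>
      (\<forall>\<phi> \<in> ?M. \<phi> ?e = x \<longrightarrow> (\<exists>c. (?e, c) \<in> parcs G \<and> \<phi> c = y))"
    proof (intro allI impI ballI)
      fix x y \<phi> assume xy: "(x, y) \<in> parcs G" and \<phi>: "\<phi> \<in> ?M" "\<phi> ?e = x"
      obtain s c where sc: "s \<in> carrier N" "c \<in> C" "x = g s" "y = g (s \<otimes>\<^bsub>N\<^esub> c)"
        using xy by (auto simp: arc_iff)
      then have "\<phi> = L s"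
        using \<phi> by (auto simp: inj_on_eq_iff[OF inj])
      \<comment> \<open>The arc from \<open>g s\<close> labelled \<open>c\<close> is the image under
        \<open>L s\<close> of the arc at \<open>?e\<close> with the same label.\<close>
      moreover have "(?e, g c) \<in> parcs G"
        unfolding arc_iff by (rule exI[of _ "\<one>\<^bsub>N\<^esub>"], rule exI[of _ c]) (use sc in \<open>simp add: CD\<close>)
      ultimately show "\<exists>c. (?e, c) \<in> parcs G \<and> \<phi> c = y"
        using sc CD by auto
    qed
  qed
qed

lemma regular_submonoid_imp_monoid_digraph:
  assumes "pair_fin_digraph G" and e: "e \<in> pverts G" and M: "submonoid M (digraph_End G)"
    and regular: "\<forall>x \<in> pverts G. \<exists>!\<phi>. \<phi> \<in> M \<and> \<phi> e = x"
    and lift: "\<forall>x y. (x, y) \<in> parcs G \<longrightarrow>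
      (\<forall>\<phi> \<in> M. \<phi> e = x \<longrightarrow> (\<exists>c. (e, c) \<in> parcs G \<and> \<phi> c = y))"
  shows "monoid_digraph G"
proof -
  interpret pair_fin_digraph G by fact
  define \<Phi> where "\<Phi> x = (THE \<phi>. \<phi> \<in> M \<and> \<phi> e = x)" for x
  have \<Phi>: "\<Phi> x \<in> M" "\<Phi> x e = x" if "x \<in> pverts G" for x
    using theI'[OF regular[rule_format, OF that]] by (simp_all add: \<Phi>_def)
  have End: "\<phi> \<in> pverts G \<rightarrow>\<^sub>E pverts G" "\<And>x y. (x, y) \<in> parcs G \<Longrightarrow> (\<phi> x, \<phi> y) \<in> parcs G"
    if "\<phi> \<in> M" for \<phi>
    using submonoid.subset[OF M] that by (auto simp: digraph_End_def)
  have closed: "\<Phi> x y \<in> pverts G" if "x \<in> pverts G" "y \<in> pverts G" for x y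
    using End(1)[OF \<Phi>(1)] that by auto
  have \<Phi>_eq: "\<Phi> x = \<phi>" if "x \<in> pverts G" "\<phi> \<in> M" "\<phi> e = x" for x \<phi>
    using regular \<Phi> that by blast
  \<comment> \<open>Both sides lie in \<open>M\<close> and send \<open>e\<close> to
    \<open>\<Phi> x y\<close>, so regularity identifies them. Evaluated at a third vertex, this is
    associativity of the product \<open>\<Phi>\<close>.\<close>
  have \<Phi>_mult: "\<Phi> (\<Phi> x y) = compose (pverts G) (\<Phi> x) (\<Phi> y)"
    if "x \<in> pverts G" "y \<in> pverts G" for x y
  proof (rule \<Phi>_eq)
    show "compose (pverts G) (\<Phi> x) (\<Phi> y) \<in> M"
      using submonoid.m_closed[OF M \<Phi>(1)[OF that(1)] \<Phi>(1)[OF that(2)]]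
      by (simp add: digraph_End_def)
  qed (use that e \<Phi> closed in \<open>simp_all add: compose_eq\<close>)
  \<comment> \<open>The identity belongs to \<open>M\<close> and fixes \<open>e\<close>. Hence
    \<open>e\<close> is a left unit; it is a right unit because
    \<open>\<Phi> x e = x\<close>.\<close>
  have \<Phi>_one: "\<Phi> e = (\<lambda>x \<in> pverts G. x)"
    by (rule \<Phi>_eq) (use e submonoid.one_closed[OF M] in \<open>simp_all add: digraph_End_def\<close>)
  define N where "N = \<lparr>carrier = pverts G, mult = \<Phi>, one = e\<rparr>"
  define C where "C = {c. (e, c) \<in> parcs G}"
  have "monoid N"
    by (rule monoidI) (simp_all add: N_def closed e \<Phi> \<Phi>_mult \<Phi>_one compose_eq)
  moreover have "finite (carrier N)"
    by (simp add: N_def)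
  moreover have "C \<subseteq> carrier N"
    by (auto simp: C_def N_def dest: in_arcsD2)
  moreover have "Cay N C = G"
  proof (rule pair_pre_digraph.equality)
    \<comment> \<open>The endomorphism \<open>\<Phi> s\<close> carries the arc \<open>(e, c)\<close>
      to \<open>(s, \<Phi> s c)\<close>.\<close>
    have "(s, \<Phi> s c) \<in> parcs G" if "s \<in> pverts G" "(e, c) \<in> parcs G" for s c
      using End(2)[OF \<Phi>(1) that(2)] \<Phi>(2) that(1) by fastforce
    \<comment> \<open>The lifting condition, applied to \<open>\<Phi> x\<close>, supplies the label
      of an arbitrary arc.\<close>
    moreover have "\<exists>c. (e, c) \<in> parcs G \<and> y = \<Phi> x c" if "(x, y) \<in> parcs G" for x y
      using lift \<Phi> that in_arcsD1[OF that] by metis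
    ultimately show "parcs (Cay N C) = parcs G"
      by (fastforce simp: Cay_def N_def C_def dest: in_arcsD1)
  qed (simp_all add: Cay_def N_def)
  ultimately show ?thesis
    using digraph_iso_refl[OF pair_wf_digraph_axioms] unfolding monoid_digraph_def by metis
qed

text \<open>The lifting condition is part of the characterisation: it is derived in one direction
  and assumed in the other. Quantifying over all \<open>\<phi> \<in> M\<close> with
  \<open>\<phi> e = x\<close> refers to the map \<open>\<phi>\<^sub>x\<close> without a choice
  operator, as the preceding clause makes it unique.\<close>

theorem lemma2p4:
  fixes G :: "'a pair_pre_digraph"
  assumes "pair_fin_digraph G"
  shows "monoid_digraph G \<longleftrightarrow>
    (\<exists>e \<in> pverts G. \<exists>M. submonoid M (digraph_End G) \<and>
       (\<forall>x \<in> pverts G. \<exists>!\<phi>. \<phi> \<in> M \<and> \<phi> e = x) \<and>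
       (\<forall>x y. (x, y) \<in> parcs G \<longrightarrow>
          (\<forall>\<phi> \<in> M. \<phi> e = x \<longrightarrow> (\<exists>c. (e, c) \<in> parcs G \<and> \<phi> c = y))))"
  (is "_ \<longleftrightarrow> ?regular")
proof
  assume "monoid_digraph G"
  then obtain e M where "e \<in> pverts G" and M: "submonoid M (digraph_End G)"
    "\<forall>x \<in> pverts G. \<exists>!\<phi>. \<phi> \<in> M \<and> \<phi> e = x"
    "\<forall>x y. (x, y) \<in> parcs G \<longrightarrow>
      (\<forall>\<phi> \<in> M. \<phi> e = x \<longrightarrow> (\<exists>c. (e, c) \<in> parcs G \<and> \<phi> c = y))"
    by (rule monoid_digraph_imp_regular_submonoid)
  then show ?regular
    by (intro bexI[of _ e] exI[of _ M] conjI)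
next
  assume ?regular
  then show "monoid_digraph G"
    by (elim bexE exE conjE) (rule regular_submonoid_imp_monoid_digraph[OF assms])
qed

end
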